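(* Let $\mathcal{H}$ be a finite hypothesis space with a prior $P$ on $\mathcal{H}$ that does not depend on the data, let $R(h,x)\in[a,a+\Delta]$ be a bounded risk, and let $X=(X_1,\dots,X_m)$ be independently sampled data points. Let $h=h(X)\in\mathcal{H}$ be a hypothesis that may depend on the training data $X$. Let $\sigma(1),\dots,\sigma(n)$ be a uniformly random sample (with or without replacement) from $\{1,\dots,m\}$, drawn independently of $X$, and let $$\hat{\hat{R}}(h)=\frac{1}{n}\sum_{i=1}^{n}R(h,X_{\sigma(i)}).$$ Then for every $\delta\in(0,1)$, with probability at least $1-\delta$ over both the randomness in $X$ and the randomness in $\sigma$, $$R(h)\le \hat{\hat{R}}(h)+\Delta\sqrt{\frac{\log\frac{1}{P(h)}+\log\frac{1}{s\delta}}{2m}}+\Delta\sqrt{\frac{\log\frac{1}{(1-s)\delta}}{2n}},\qquad\text{where } s=\frac{n}{n+m}.$$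
   Context: $m,n\ge 1$ are integers (with $n\le m$ when sampling without replacement), $a\in\mathbb{R}$ and $\Delta>0$. A prior $P$ on the finite set $\mathcal{H}$ is a probability distribution on $\mathcal{H}$, fixed independently of $X$. $\log$ is the natural logarithm, with $\log(1/0)=+\infty$. For a fixed hypothesis $g\in\mathcal{H}$, the empirical risk is $\hat{R}(g)=\frac{1}{m}\sum_{i=1}^m R(g,X_i)$, a sum over independent random variables, and the expected risk is $R(g)=\mathbb{E}[\hat{R}(g)]$, the expectation being over $X$ with $g$ fixed. For the data-dependent hypothesis $h=h(X)$, $R(h)$ denotes the function $g\mapsto R(g)$ evaluated at $g=h(X)$. The sample $\sigma$ is used only for evaluating the risk: $h$ depends on $X$ but not on $\sigma$. *)

theory Defs
  imports "HOL-Probability.Probability"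
begin

(* Total extensions of ln and sqrt to ereal.  The values at \<infinity> realise the
   convention log (1/0) = \<infinity>; note that 1 / (0::ereal) = \<infinity>.  The values at
   arguments that do not occur in the bound (ln of numbers \<le> 0, sqrt of -\<infinity>)
   are the usual limits or arbitrary. *)

definition eln :: "ereal \<Rightarrow> ereal" where
  "eln x = (if x = \<infinity> then \<infinity> else if 0 < x then ereal (ln (real_of_ereal x)) else -\<infinity>)"

definition esqrt :: "ereal \<Rightarrow> ereal" where
  "esqrt x = (if \<bar>x\<bar> = \<infinity> then x else ereal (sqrt (real_of_ereal x)))"

lemma eln_ereal [simp]: "0 < r \<Longrightarrow> eln (ereal r) = ereal (ln r)"
  and eln_infinity [simp]: "eln \<infinity> = \<infinity>"
  by (simp_all add: eln_def)

lemma esqrt_ereal [simp]: "esqrt (ereal r) = ereal (sqrt r)"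
  and esqrt_infinity [simp]: "esqrt \<infinity> = \<infinity>"
  by (simp_all add: esqrt_def)

lemma eln_recip:
  assumes "0 \<le> p"
  shows "eln (1 / ereal p) = (if p = 0 then \<infinity> else ereal (ln (1 / p)))"
proof (cases "p = 0")
  case True
  have "1 / ereal p = (\<infinity>::ereal)"
    unfolding True zero_ereal_def[symmetric] by (simp add: divide_ereal_def)
  with True show ?thesis by (simp only: eln_infinity if_True refl)
next
  case False
  then have "1 / ereal p = ereal (1 / p)" by (simp add: one_ereal_def)
  with False assms show ?thesis by (simp only: if_False) simp
qed

(* The library's indep_var requires both variables to have the same value type. *)
definition indep_rvs ::
  "'w measure \<Rightarrow> 'a measure \<Rightarrow> ('w \<Rightarrow> 'a) \<Rightarrow> 'b measure \<Rightarrow> ('w \<Rightarrow> 'b) \<Rightarrow> bool" where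
  "indep_rvs M A Y B Z \<longleftrightarrow> Y \<in> measurable M A \<and> Z \<in> measurable M B \<and>
     prob_space.indep_set M {Y -` S \<inter> space M | S. S \<in> sets A} {Z -` T \<inter> space M | T. T \<in> sets B}"

datatype sampling = With_Replacement | Without_Replacement

(* Ordered samples (\<sigma>(1), ..., \<sigma>(n)) of indices from {1..m}, as extensional functions. *)
fun index_samples :: "sampling \<Rightarrow> nat \<Rightarrow> nat \<Rightarrow> (nat \<Rightarrow> nat) set" where
  "index_samples With_Replacement n m = ({1..n} \<rightarrow>\<^sub>E {1..m})"
| "index_samples Without_Replacement n m = {f \<in> {1..n} \<rightarrow>\<^sub>E {1..m}. inj_on f {1..n}}"

definition data_vec :: "nat \<Rightarrow> (nat \<Rightarrow> 'w \<Rightarrow> 'x) \<Rightarrow> 'w \<Rightarrow> nat \<Rightarrow> 'x" where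
  "data_vec m X \<omega> = (\<lambda>i\<in>{1..m}. X i \<omega>)"

definition emp_risk :: "('h \<Rightarrow> 'x \<Rightarrow> real) \<Rightarrow> nat \<Rightarrow> (nat \<Rightarrow> 'x) \<Rightarrow> 'h \<Rightarrow> real" where
  "emp_risk R m x g = (1 / real m) * (\<Sum>i=1..m. R g (x i))"

definition exp_risk ::
  "'w measure \<Rightarrow> ('h \<Rightarrow> 'x \<Rightarrow> real) \<Rightarrow> nat \<Rightarrow> (nat \<Rightarrow> 'w \<Rightarrow> 'x) \<Rightarrow> 'h \<Rightarrow> real" where
  "exp_risk M R m X g = (LINT \<omega>|M. emp_risk R m (data_vec m X \<omega>) g)"

definition sub_risk ::
  "('h \<Rightarrow> 'x \<Rightarrow> real) \<Rightarrow> nat \<Rightarrow> (nat \<Rightarrow> nat) \<Rightarrow> (nat \<Rightarrow> 'x) \<Rightarrow> 'h \<Rightarrow> real" where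
  "sub_risk R n \<sigma> x g = (1 / real n) * (\<Sum>i=1..n. R g (x (\<sigma> i)))"

end

theory Submission
  imports Defs
begin

text \<open>
  Each hypothesis \<open>g\<close> receives the share \<open>P(g) s \<delta>\<close> of the failure probability in Hoeffding's inequality
  over \<open>X\<close>, so a union bound controls \<open>R(h)\<close> by the full empirical risk except with probability
  \<open>s \<delta>\<close>. For every fixed data vector, the subsampled risk is controlled by a second Hoeffding bound
  over the uniform index sample, which fails with probability at most \<open>(1 - s) \<delta>\<close>; by independence
  this bound survives averaging over \<open>X\<close>. Without replacement the moment generating function is
  bounded by induction on the number of draws: after a first draw the rest is a sample from a
  smaller population, whose mean has shifted against the drawn value.
\<close>

section \<open>Exponential moments of uniform samples from a finite population\<close>

text \<open>Hoeffding's lemma for the uniform distribution on \<open>J\<close>, multiplied through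
  by \<open>card J\<close> so that later arguments are about finite sums only. Hoeffding's lemma is
  applied for \<open>l > 0\<close>; at \<open>l = 0\<close> both sides equal
  \<open>card J\<close>.\<close>

lemma sum_exp_le_Hoeffding:
  fixes c :: "'a \<Rightarrow> real"
  assumes J: "finite J" "J \<noteq> {}" and c: "\<And>j. j \<in> J \<Longrightarrow> c j \<in> {a..b}" and "l \<ge> 0"
  shows "(\<Sum>j\<in>J. exp (l * c j))
           \<le> card J * exp (l * (\<Sum>j\<in>J. c j) / card J + l\<^sup>2 * (b - a)\<^sup>2 / 8)"
proof (cases "l = 0")
  case False
  with \<open>l \<ge> 0\<close> have l: "l > 0" by simp
  interpret interval_bounded_random_variable "measure_pmf (pmf_of_set J)" c a b
    by unfold_locales (auto simp: AE_measure_pmf_iff set_pmf_of_set J c[simplified])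
  define \<mu> where "\<mu> = (\<Sum>j\<in>J. c j) / card J"
  have E: "measure_pmf.expectation (pmf_of_set J) c = \<mu>"
    unfolding \<mu>_def using integral_pmf_of_set[OF J(2,1), of c] by simp
  have "card J > 0"
    using J by (simp add: card_gt_0_iff)
  have "nn_integral (measure_pmf (pmf_of_set J)) (\<lambda>x. exp (l * (c x - \<mu>)))
      = (\<Sum>j\<in>J. ennreal (exp (l * (c j - \<mu>)))) / card J"
    using J by (simp add: nn_integral_pmf_of_set)
  also have "\<dots> = ennreal ((\<Sum>j\<in>J. exp (l * (c j - \<mu>))) / card J)"
    using \<open>card J > 0\<close> by (simp add: sum_ennreal divide_ennreal sum_nonneg ennreal_of_nat_eq_real_of_nat)
  finally have "ennreal ((\<Sum>j\<in>J. exp (l * (c j - \<mu>))) / card J) \<le> ennreal (exp (l\<^sup>2 * (b - a)\<^sup>2 / 8))"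
    using Hoeffdings_lemma_nn_integral[OF l] by (simp only: E)
  hence "(\<Sum>j\<in>J. exp (l * (c j - \<mu>))) / card J \<le> exp (l\<^sup>2 * (b - a)\<^sup>2 / 8)"
    by simp
  hence "(\<Sum>j\<in>J. exp (l * (c j - \<mu>))) \<le> card J * exp (l\<^sup>2 * (b - a)\<^sup>2 / 8)"
    using \<open>card J > 0\<close> by (simp add: field_simps)
  moreover have "(\<Sum>j\<in>J. exp (l * c j)) = exp (l * \<mu>) * (\<Sum>j\<in>J. exp (l * (c j - \<mu>)))"
    by (simp add: sum_distrib_left algebra_simps flip: exp_add)
  ultimately have "(\<Sum>j\<in>J. exp (l * c j)) \<le> exp (l * \<mu>) * (card J * exp (l\<^sup>2 * (b - a)\<^sup>2 / 8))"
    by (simp add: mult_left_mono)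
  thus ?thesis
    by (simp add: \<mu>_def exp_add mult_ac)
qed auto

text \<open>For \<open>I = {1..n}\<close> and \<open>J = {1..m}\<close> this is the sample space
  without replacement. General \<open>I\<close> and \<open>J\<close> let the induction strip one
  draw from \<open>I\<close> and the drawn value from \<open>J\<close>.\<close>

abbreviation inj_funs :: "'i set \<Rightarrow> 'a set \<Rightarrow> ('i \<Rightarrow> 'a) set" where
  "inj_funs I J \<equiv> {f \<in> I \<rightarrow>\<^sub>E J. inj_on f I}"

lemma finite_inj_funs: "finite I \<Longrightarrow> finite J \<Longrightarrow> finite (inj_funs I J)"
  by (simp add: finite_PiE)

text \<open>Splits a sample by its draw \<open>j\<close> at position \<open>k\<close>; injectivity
  confines the other draws to \<open>J - {j}\<close>.\<close>

lemma sum_inj_funs_insert: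
  assumes "k \<notin> I" and fin: "finite I" "finite J"
  shows "sum F (inj_funs (insert k I) J) = (\<Sum>j\<in>J. \<Sum>f\<in>inj_funs I (J - {j}). F (f(k := j)))"
proof -
  let ?S = "{(j, f). j \<in> J \<and> f \<in> I \<rightarrow>\<^sub>E (J - {j}) \<and> inj_on f I}"
  have S: "?S = (SIGMA j:J. inj_funs I (J - {j}))" by auto
  have "sum F (inj_funs (insert k I) J) = sum F ((\<lambda>(j, f). f(k := j)) ` ?S)"
    by (simp only: extensional_funcset_extend_domain_inj_on_eq[OF assms(1)])
  also have "\<dots> = (\<Sum>(j, f)\<in>?S. F (f(k := j)))"
    by (subst sum.reindex[OF extensional_funcset_extend_domain_inj_onI[OF assms(1)]])
      (simp add: o_def case_prod_unfold)
  also have "\<dots> = (\<Sum>j\<in>J. \<Sum>f\<in>inj_funs I (J - {j}). F (f(k := j)))"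
    unfolding S by (rule sum.Sigma[symmetric]) (use fin finite_inj_funs[OF fin(1)] in blast)+
  finally show ?thesis .
qed

text \<open>A falling factorial. With truncated subtraction it contains the factor 0 when
  \<open>card I > card J\<close>, matching the absence of injections.\<close>

lemma card_inj_funs:
  assumes "finite I" "finite J"
  shows "card (inj_funs I J) = (\<Prod>i<card I. card J - i)"
  using assms
proof (induction I arbitrary: J rule: finite_induct)
  case empty
  have "inj_funs {} J = {\<lambda>_. undefined}" by auto
  then show ?case by simp
next
  case (insert k I)
  have "card (inj_funs (insert k I) J) = (\<Sum>j\<in>J. card (inj_funs I (J - {j})))"
    using sum_inj_funs_insert[of k I J "\<lambda>_. 1::nat"] insert by simp
  also have "\<dots> = (\<Sum>j\<in>J. \<Prod>i<card I. card J - Suc i)"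
    using insert by (intro sum.cong) simp_all
  also have "\<dots> = (\<Prod>i<card (insert k I). card J - i)"
    using insert by (simp add: prod.lessThan_Suc_shift del: prod.lessThan_Suc)
  finally show ?case .
qed

text \<open>Draws without replacement are dependent, so the exponential moment does not factor over
  \<open>I\<close>. The bound still has the form obtained for independent draws, which lets both
  sampling modes share one tail estimate.\<close>

lemma sum_exp_inj_funs_le:
  fixes c :: "'a \<Rightarrow> real"
  assumes "finite I" "finite J" and "card I \<le> card J"
    and "\<And>j. j \<in> J \<Longrightarrow> c j \<in> {a..b}" and "l \<ge> 0"
  shows "(\<Sum>f\<in>inj_funs I J. exp (l * (\<Sum>i\<in>I. c (f i))))
           \<le> card (inj_funs I J)
              * exp (card I * (l * (\<Sum>j\<in>J. c j) / card J + l\<^sup>2 * (b - a)\<^sup>2 / 8))"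
  using assms(1-4)
proof (induction I arbitrary: J rule: finite_induct)
  case empty
  have "inj_funs {} J = {\<lambda>_. undefined}" by auto
  then show ?case by simp
next
  \<comment> \<open>Condition on the first draw \<open>j\<close>: the mean of the remaining draws is an affine function
    of \<open>c j\<close>, so \<open>c j\<close> enters the exponent with the reduced weight \<open>\<alpha>\<close> and Hoeffding's lemma
    applies to \<open>l * \<alpha>\<close>.\<close>
  case (insert k I)
  define n where "n = card I"
  define M where "M = real (card J - 1)"
  define S where "S = (\<Sum>j\<in>J. c j)"
  \<comment> \<open>\<open>M\<close> is the population size left after one draw. If it is 0, then
    \<open>n = 0\<close>, and division by zero yields \<open>\<alpha> = 1\<close>.\<close>
  define \<alpha> where "\<alpha> = 1 - n / M"
  \<comment> \<open>The number of ways to complete a sample after its first draw; it is the same for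
    every \<open>j\<close> and so leaves the sum over \<open>j\<close>.\<close>
  define K where "K = real (\<Prod>i<n. (card J - 1) - i)"
  define B where "B = l\<^sup>2 * (b - a)\<^sup>2 / 8"
  from insert have "card J \<ge> Suc n" by (simp add: n_def)
  hence M: "card J = M + 1" "M \<ge> n" by (auto simp: M_def)
  have J: "J \<noteq> {}" using \<open>card J \<ge> Suc n\<close> by auto
  have \<alpha>: "0 \<le> \<alpha>" "\<alpha> \<le> 1" using M by (auto simp: \<alpha>_def divide_le_eq)
  have K: "card (inj_funs I (J - {j})) = K" if "j \<in> J" for j
    using insert that by (simp add: card_inj_funs K_def n_def)
  have "K \<ge> 0" unfolding K_def by (rule of_nat_0_le_iff)
  have card: "card (inj_funs (insert k I) J) = card J * K"
  proof -
    have "card (inj_funs (insert k I) J) = (\<Prod>i<Suc n. card J - i)"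
      using insert by (subst card_inj_funs) (auto simp: n_def)
    also have "\<dots> = card J * (\<Prod>i<n. card J - 1 - i)"
      by (subst prod.lessThan_Suc_shift) simp
    finally show ?thesis
      by (simp add: K_def)
  qed
  have step: "(\<Sum>f\<in>inj_funs I (J - {j}). exp (l * (\<Sum>i\<in>insert k I. c ((f(k := j)) i))))
         \<le> K * exp (n * (l * S / M + B)) * exp (l * \<alpha> * c j)" if j: "j \<in> J" for j
  proof -
    have "(\<Sum>i\<in>I. c ((f(k := j)) i)) = (\<Sum>i\<in>I. c (f i))" for f
      using insert by (intro sum.cong) auto
    hence "(\<Sum>f\<in>inj_funs I (J - {j}). exp (l * (\<Sum>i\<in>insert k I. c ((f(k := j)) i))))
        = exp (l * c j) * (\<Sum>f\<in>inj_funs I (J - {j}). exp (l * (\<Sum>i\<in>I. c (f i))))"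
      using insert by (simp add: sum_distrib_left distrib_left exp_add)
    also have "\<dots> \<le> exp (l * c j) * (K * exp (n * (l * (\<Sum>j\<in>J - {j}. c j) / M + B)))"
      using insert.IH[of "J - {j}"] insert.prems insert.hyps j \<open>card J \<ge> Suc n\<close>
      by (intro mult_left_mono) (simp_all add: K n_def M_def B_def)
    also have "(\<Sum>j\<in>J - {j}. c j) = S - c j"
      using insert j by (simp add: S_def sum_diff1)
    also have "exp (l * c j) * (K * exp (n * (l * (S - c j) / M + B)))
        = K * exp (l * c j + n * (l * (S - c j) / M + B))"
      by (simp add: exp_add)
    also have "l * c j + n * (l * (S - c j) / M + B) = n * (l * S / M + B) + l * \<alpha> * c j"
      unfolding \<alpha>_def by (simp add: algebra_simps diff_divide_distrib)
    finally show ?thesis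
      by (simp add: exp_add)
  qed
  have "(\<Sum>f\<in>inj_funs (insert k I) J. exp (l * (\<Sum>i\<in>insert k I. c (f i))))
      = (\<Sum>j\<in>J. \<Sum>f\<in>inj_funs I (J - {j}). exp (l * (\<Sum>i\<in>insert k I. c ((f(k := j)) i))))"
    using insert by (intro sum_inj_funs_insert) auto
  also have "\<dots> \<le> (\<Sum>j\<in>J. K * exp (n * (l * S / M + B)) * exp (l * \<alpha> * c j))"
    by (intro sum_mono step)
  also have "\<dots> = K * exp (n * (l * S / M + B)) * (\<Sum>j\<in>J. exp (l * \<alpha> * c j))"
    by (simp add: sum_distrib_left)
  also have "\<dots> \<le> K * exp (n * (l * S / M + B))
      * (card J * exp (l * \<alpha> * S / card J + (l * \<alpha>)\<^sup>2 * (b - a)\<^sup>2 / 8))"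
    unfolding S_def using insert.prems J \<open>l \<ge> 0\<close> \<alpha> \<open>K \<ge> 0\<close>
    by (intro mult_left_mono sum_exp_le_Hoeffding) auto
  also have "\<dots> = card J * K
      * exp (n * (l * S / M + B) + (l * \<alpha> * S / card J + (l * \<alpha>)\<^sup>2 * (b - a)\<^sup>2 / 8))"
    by (simp add: exp_add)
  also have "\<dots> \<le> card J * K * exp (Suc n * (l * S / card J + B))"
  proof -
    \<comment> \<open>The gain from the reduced weight \<open>\<alpha>\<close> is given away here:
      the first draw is charged a full \<open>B\<close>.\<close>
    have "(l * \<alpha>)\<^sup>2 * (b - a)\<^sup>2 / 8 = \<alpha>\<^sup>2 * B"
      by (simp add: B_def power_mult_distrib)
    also have "\<dots> \<le> B"
      using \<alpha> by (intro mult_left_le_one_le) (auto simp: B_def power_le_one)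
    finally have 1: "(l * \<alpha>)\<^sup>2 * (b - a)\<^sup>2 / 8 \<le> B" .
    \<comment> \<open>The mean terms recombine without loss:
      \<open>n / M + (1 - n / M) / (M + 1) = (n + 1) / (M + 1)\<close>. The case
      \<open>M = 0\<close> is separate because of the division.\<close>
    have 2: "n * (l * S / M) + l * \<alpha> * S / card J = Suc n * (l * S / card J)"
    proof (cases "M = 0")
      case True
      with M have "n = 0" by simp
      with True show ?thesis by (simp add: \<alpha>_def)
    next
      case False
      with M have "M > 0" by simp
      thus ?thesis by (simp add: \<alpha>_def M add_pos_pos divide_simps) (simp add: algebra_simps)
    qed
    have "n * (l * S / M + B) + (l * \<alpha> * S / card J + (l * \<alpha>)\<^sup>2 * (b - a)\<^sup>2 / 8)
        = (n * (l * S / M) + l * \<alpha> * S / card J) + (n * B + (l * \<alpha>)\<^sup>2 * (b - a)\<^sup>2 / 8)"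
      by (simp add: algebra_simps)
    also have "\<dots> \<le> Suc n * (l * S / card J + B)"
      unfolding 2 using 1 by (simp add: algebra_simps)
    finally show ?thesis
      using \<open>K \<ge> 0\<close> by (intro mult_left_mono) auto
  qed
  finally show ?case
    using insert card by (simp add: n_def S_def B_def)
qed

text \<open>With replacement the coordinates range independently over \<open>J\<close>, so the sum
  over all functions is a power of the single-draw sum.\<close>

lemma sum_exp_PiE_le:
  fixes c :: "'a \<Rightarrow> real"
  assumes "finite I" "finite J" "J \<noteq> {}"
    and "\<And>j. j \<in> J \<Longrightarrow> c j \<in> {a..b}" and "l \<ge> 0"
  shows "(\<Sum>f\<in>I \<rightarrow>\<^sub>E J. exp (l * (\<Sum>i\<in>I. c (f i))))
           \<le> card (I \<rightarrow>\<^sub>E J)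
              * exp (card I * (l * (\<Sum>j\<in>J. c j) / card J + l\<^sup>2 * (b - a)\<^sup>2 / 8))"
proof -
  have "(\<Sum>f\<in>I \<rightarrow>\<^sub>E J. exp (l * (\<Sum>i\<in>I. c (f i))))
      = (\<Sum>f\<in>I \<rightarrow>\<^sub>E J. \<Prod>i\<in>I. exp (l * c (f i)))"
    using assms by (simp add: sum_distrib_left exp_sum)
  also have "\<dots> = (\<Sum>j\<in>J. exp (l * c j)) ^ card I"
    using prod_sum_PiE[of I "\<lambda>_. J" "\<lambda>_ j. exp (l * c j)"] assms by simp
  also have "\<dots> \<le> (card J * exp (l * (\<Sum>j\<in>J. c j) / card J + l\<^sup>2 * (b - a)\<^sup>2 / 8)) ^ card I"
    using assms by (intro power_mono sum_exp_le_Hoeffding sum_nonneg) auto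
  finally show ?thesis
    using assms by (simp add: card_PiE power_mult_distrib exp_of_nat_mult)
qed

section \<open>Tail bound for the subsampled mean\<close>

lemma finite_index_samples: "finite (index_samples mode n m)"
  by (cases mode) (auto simp only: index_samples.simps intro!: finite_PiE finite_inj_funs)

lemma index_samples_mem: "f \<in> index_samples mode n m \<Longrightarrow> i \<in> {1..n} \<Longrightarrow> f i \<in> {1..m}"
  by (cases mode) (auto simp: PiE_def Pi_def)

text \<open>Chernoff's method in counting form, fed by the exponential moment bound of the
  respective sampling mode.\<close>

lemma index_samples_tail:
  fixes c :: "nat \<Rightarrow> real"
  assumes "m \<ge> 1" "n \<ge> 1" and "mode = Without_Replacement \<Longrightarrow> n \<le> m"
    and c: "\<And>j. j \<in> {1..m} \<Longrightarrow> c j \<in> {a..b}" and "a < b" and "t \<ge> 0"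
  shows "card {f \<in> index_samples mode n m. (\<Sum>i=1..n. c (f i)) / n \<le> (\<Sum>j=1..m. c j) / m - t}
           \<le> card (index_samples mode n m) * exp (- 2 * real n * t\<^sup>2 / (b - a)\<^sup>2)"
proof -
  \<comment> \<open>The minimiser of \<open>l\<^sup>2 * (b - a)\<^sup>2 / 8 - l * t\<close>, whose
    minimum is \<open>- 2 * t\<^sup>2 / (b - a)\<^sup>2\<close>.\<close>
  define l where "l = 4 * t / (b - a)\<^sup>2"
  define \<mu> where "\<mu> = (\<Sum>j=1..m. c j) / m"
  let ?IS = "index_samples mode n m"
  let ?T = "{f \<in> ?IS. (\<Sum>i=1..n. c (f i)) / n \<le> \<mu> - t}"
  have "l \<ge> 0" using assms by (simp add: l_def)
  have "card ?T * exp (l * (n * (t - \<mu>))) = (\<Sum>f\<in>?T. exp (l * (n * (t - \<mu>))))"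
    by simp
  also have "\<dots> \<le> (\<Sum>f\<in>?T. exp (l * (\<Sum>i=1..n. - c (f i))))"
  proof (rule sum_mono)
    fix f assume "f \<in> ?T"
    hence "n * (t - \<mu>) \<le> (\<Sum>i=1..n. - c (f i))"
      using \<open>n \<ge> 1\<close> by (simp add: sum_negf field_simps)
    thus "exp (l * (n * (t - \<mu>))) \<le> exp (l * (\<Sum>i=1..n. - c (f i)))"
      using \<open>l \<ge> 0\<close> by (simp add: mult_left_mono)
  qed
  also have "\<dots> \<le> (\<Sum>f\<in>?IS. exp (l * (\<Sum>i=1..n. - c (f i))))"
    by (intro sum_mono2) (auto simp: finite_index_samples)
  \<comment> \<open>The lower tail of \<open>c\<close> is the upper tail of \<open>- c\<close>,
    whose values lie in \<open>{- b..- a}\<close>.\<close>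
  also have "\<dots> \<le> card ?IS * exp (card {1..n} * (l * (\<Sum>j=1..m. - c j) / card {1..m} + l\<^sup>2 * (- a - (- b))\<^sup>2 / 8))"
  proof (cases mode)
    case With_Replacement
    have "{1..m} \<noteq> {}" using \<open>m \<ge> 1\<close> by simp
    with c \<open>l \<ge> 0\<close> show ?thesis unfolding With_Replacement index_samples.simps
      by (intro sum_exp_PiE_le) auto
  next
    case Without_Replacement
    with assms(3) c \<open>l \<ge> 0\<close> show ?thesis unfolding Without_Replacement index_samples.simps
      by (intro sum_exp_inj_funs_le) auto
  qed
  also have "card {1..n} * (l * (\<Sum>j=1..m. - c j) / card {1..m} + l\<^sup>2 * (- a - (- b))\<^sup>2 / 8)
      = l * (n * (t - \<mu>)) + - 2 * real n * t\<^sup>2 / (b - a)\<^sup>2"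
  proof -
    have "l\<^sup>2 * (b - a)\<^sup>2 / 8 - l * t = - 2 * t\<^sup>2 / (b - a)\<^sup>2"
    proof -
      have "(b - a)\<^sup>2 > 0" using \<open>a < b\<close> by simp
      thus ?thesis by (simp add: l_def power2_eq_square[of "4 * t / _"] power2_eq_square[of t] field_simps)
    qed
    hence "l\<^sup>2 * (b - a)\<^sup>2 / 8 = l * t - 2 * t\<^sup>2 / (b - a)\<^sup>2"
      by simp
    moreover have "l * (\<Sum>j=1..m. - c j) / card {1..m} = - l * \<mu>"
      by (simp add: \<mu>_def sum_negf)
    moreover have "(- a - (- b))\<^sup>2 = (b - a)\<^sup>2"
      by (simp add: power2_eq_square algebra_simps)
    ultimately show ?thesis
      by (simp only: card_atLeastAtMost) (simp add: algebra_simps)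
  qed
  finally have "card ?T * exp (l * (n * (t - \<mu>)))
      \<le> card ?IS * exp (- 2 * real n * t\<^sup>2 / (b - a)\<^sup>2) * exp (l * (n * (t - \<mu>)))"
    by (simp only: exp_add mult_ac)
  thus ?thesis
    by (simp add: \<mu>_def)
qed

section \<open>Failure probabilities over the index sample and over the data\<close>

text \<open>A finite Fubini argument: independence turns the probability into an average over
  \<open>f\<close> of the events \<open>Y \<omega> \<in> D f\<close>, and exchanging sum and
  expectation reduces it to the count for each fixed value of \<open>Y\<close>.\<close>

lemma (in prob_space) prob_indep_uniform_le:
  fixes p :: real
  assumes indep: "indep_rvs M A Y (count_space S) Z"
    and distr: "distr M (count_space S) Z = uniform_count_measure S"
    and S: "finite S" and D: "\<And>f. f \<in> S \<Longrightarrow> D f \<in> sets A"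
    and card: "\<And>x. x \<in> space A \<Longrightarrow> card {f \<in> S. x \<in> D f} \<le> card S * p"
  shows "prob {\<omega> \<in> space M. Y \<omega> \<in> D (Z \<omega>)} \<le> p"
proof -
  have Y: "Y \<in> measurable M A" and Z: "Z \<in> measurable M (count_space S)"
    and ind: "indep_set {Y -` T \<inter> space M | T. T \<in> sets A}
                {Z -` T \<inter> space M | T. T \<in> sets (count_space S)}"
    using indep by (auto simp: indep_rvs_def)
  let ?V = "\<lambda>f. Y -` D f \<inter> space M" and ?W = "\<lambda>f. Z -` {f} \<inter> space M"
  have V: "?V f \<in> events" if "f \<in> S" for f
    using measurable_sets[OF Y D[OF that]] .
  have W: "?W f \<in> events" if "f \<in> S" for f
    using measurable_sets[OF Z, of "{f}"] that by simp
  have pW: "prob (?W f) = 1 / card S" if "f \<in> S" for f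
  proof -
    have "prob (?W f) = measure (distr M (count_space S) Z) {f}"
      using that by (subst measure_distr[OF Z]) auto
    thus ?thesis
      using that S by (simp add: distr measure_uniform_count_measure)
  qed
  obtain \<omega>0 where "\<omega>0 \<in> space M" using not_empty by blast
  hence "Z \<omega>0 \<in> S" using measurable_space[OF Z] by simp
  hence cS: "card S > 0" using S by (auto simp: card_gt_0_iff)
  have "{\<omega> \<in> space M. Y \<omega> \<in> D (Z \<omega>)} = (\<Union>f\<in>S. ?V f \<inter> ?W f)"
    using measurable_space[OF Z] by auto
  \<comment> \<open>The union is disjoint, but subadditivity is enough for an upper bound.\<close>
  also have "prob \<dots> \<le> (\<Sum>f\<in>S. prob (?V f \<inter> ?W f))"
    using S V W by (intro finite_measure_subadditive_finite) auto
  also have "\<dots> = (\<Sum>f\<in>S. prob (?V f) * prob (?W f))"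
    using D by (intro sum.cong refl indep_setD[OF ind]) auto
  also have "\<dots> = (\<Sum>f\<in>S. prob (?V f)) / card S"
    by (simp add: pW sum_divide_distrib)
  also have "(\<Sum>f\<in>S. prob (?V f)) = (\<Sum>f\<in>S. expectation (indicator (?V f)))"
    using V by simp
  also have "\<dots> = expectation (\<lambda>\<omega>. \<Sum>f\<in>S. indicator (?V f) \<omega>)"
    using V by (subst Bochner_Integration.integral_sum) (auto simp: emeasure_finite less_top[symmetric])
  also have "\<dots> \<le> expectation (\<lambda>\<omega>. card S * p)"
  proof (rule integral_mono)
    fix \<omega> assume \<omega>: "\<omega> \<in> space M"
    have "(\<Sum>f\<in>S. indicator (?V f) \<omega>) = real (card {f \<in> S. Y \<omega> \<in> D f})"
      using \<omega> S by (simp add: indicator_def sum.If_cases Int_def)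
    also have "\<dots> \<le> card S * p"
      using measurable_space[OF Y \<omega>] by (rule card)
    finally show "(\<Sum>f\<in>S. indicator (?V f) \<omega>) \<le> card S * p" .
  qed (use V in \<open>auto simp: emeasure_finite less_top[symmetric]\<close>)
  finally show ?thesis
    using cS by (simp add: prob_space divide_right_mono field_simps)
qed

text \<open>Since \<open>g\<close> is fixed before the data, the risks
  \<open>R g (X i \<omega>)\<close> are independent and bounded, and Hoeffding's inequality applies
  to their sum.\<close>

lemma (in prob_space) prob_emp_risk_le:
  assumes "indep_vars (\<lambda>_. N) X {1..m}" and m: "m \<ge> 1"
    and R: "R g \<in> borel_measurable N" "\<And>x. x \<in> space N \<Longrightarrow> R g x \<in> {a..a + \<Delta>}"
    and "\<Delta> > 0" "t \<ge> 0"
  shows "prob {\<omega> \<in> space M. emp_risk R m (data_vec m X \<omega>) g \<le> exp_risk M R m X g - t}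
           \<le> exp (- 2 * real m * t\<^sup>2 / \<Delta>\<^sup>2)"
proof -
  define Y where "Y = (\<lambda>i \<omega>. R g (X i \<omega>))"
  define \<mu> where "\<mu> = (\<Sum>i\<in>{1..m}. expectation (Y i))"
  have X: "X i \<in> measurable M N" if "i \<in> {1..m}" for i
    using assms(1) that by (auto simp: indep_vars_def)
  interpret Hoeffding_ineq M "{1..m}" Y "\<lambda>_. a" "\<lambda>_. a + \<Delta>" \<mu>
  proof unfold_locales
    show "indep_vars (\<lambda>_. borel) Y {1..m}"
      unfolding Y_def using assms(1) R(1) by (rule indep_vars_compose2)
    show "AE \<omega> in M. Y i \<omega> \<in> {a..a + \<Delta>}" if "i \<in> {1..m}" for i
      unfolding Y_def using measurable_space[OF X[OF that]] R(2) by (intro AE_I2) blast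
  qed (simp_all add: \<mu>_def)
  have emp: "emp_risk R m (data_vec m X \<omega>) g = (\<Sum>i=1..m. Y i \<omega>) / m" for \<omega>
    by (simp add: emp_risk_def data_vec_def Y_def)
  have int: "integrable M (Y i)" if "i \<in> {1..m}" for i
    using interval_bounded_random_variable.integrable[OF bounded_random_variable[OF that]] .
  have exp: "exp_risk M R m X g = \<mu> / m"
    using int by (simp add: exp_risk_def emp \<mu>_def)
  have "{\<omega> \<in> space M. emp_risk R m (data_vec m X \<omega>) g \<le> exp_risk M R m X g - t}
      = {\<omega> \<in> space M. (\<Sum>i=1..m. Y i \<omega>) \<le> \<mu> - m * t}"
    using m by (simp add: emp exp field_simps)
  \<comment> \<open>The sum deviates by \<open>m * t\<close> and the squared ranges add up to
    \<open>m * \<Delta>\<^sup>2\<close>, so one factor \<open>m\<close> survives.\<close>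
  also have "prob \<dots> \<le> exp (- 2 * (m * t)\<^sup>2 / (\<Sum>i\<in>{1..m}. (a + \<Delta> - a)\<^sup>2))"
    using m assms by (intro Hoeffding_ineq_le) auto
  also have "- 2 * (m * t)\<^sup>2 / (\<Sum>i\<in>{1..m}. (a + \<Delta> - a)\<^sup>2) = - 2 * real m * t\<^sup>2 / \<Delta>\<^sup>2"
    using m by (simp add: power_mult_distrib power2_eq_square field_simps)
  finally show ?thesis .
qed

text \<open>Calibrates the deviation: the square-root radii of the theorem are those whose Hoeffding
  failure probability is \<open>exp (- L)\<close>.\<close>

lemma exp_Hoeffding_radius:
  assumes "\<Delta> > 0" "k \<ge> 1" "L \<ge> 0"
  shows "exp (- 2 * real k * (\<Delta> * sqrt (L / (2 * real k)))\<^sup>2 / \<Delta>\<^sup>2) = exp (- L)"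
  using assms by (simp add: power_mult_distrib)

section \<open>The bound for the data-dependent hypothesis\<close>

theorem mainTheorem1:
  fixes M :: "'w measure" and N :: "'x measure"
    and H :: "'h set" and P :: "'h pmf"
    and R :: "'h \<Rightarrow> 'x \<Rightarrow> real" and a \<Delta> \<delta> s :: real
    and m n :: nat and mode :: sampling
    and X :: "nat \<Rightarrow> 'w \<Rightarrow> 'x" and \<sigma> :: "'w \<Rightarrow> nat \<Rightarrow> nat"
    and h :: "(nat \<Rightarrow> 'x) \<Rightarrow> 'h"
  assumes "prob_space M"
    and "m \<ge> 1" and "n \<ge> 1"
    and "mode = Without_Replacement \<Longrightarrow> n \<le> m"
    and "finite H" and "set_pmf P \<subseteq> H"
    and "\<Delta> > 0"
    and "\<And>g. g \<in> H \<Longrightarrow> R g \<in> borel_measurable N"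
    and "\<And>g x. g \<in> H \<Longrightarrow> x \<in> space N \<Longrightarrow> R g x \<in> {a..a + \<Delta>}"
    and "prob_space.indep_vars M (\<lambda>_. N) X {1..m}"
    and "h \<in> measurable (PiM {1..m} (\<lambda>_. N)) (count_space H)"
    and "indep_rvs M (PiM {1..m} (\<lambda>_. N)) (data_vec m X)
                     (count_space (index_samples mode n m)) \<sigma>"
    and "distr M (count_space (index_samples mode n m)) \<sigma>
           = uniform_count_measure (index_samples mode n m)"
    and "0 < \<delta>" and "\<delta> < 1"
    and "s = real n / (real n + real m)"
  shows "\<P>(\<omega> in M.
      ereal (exp_risk M R m X (h (data_vec m X \<omega>)))
        \<le> ereal (sub_risk R n (\<sigma> \<omega>) (data_vec m X \<omega>) (h (data_vec m X \<omega>)))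
          + ereal \<Delta> * esqrt ((eln (1 / ereal (pmf P (h (data_vec m X \<omega>)))) + ereal (ln (1 / (s * \<delta>))))
                              / ereal (2 * real m))
          + ereal (\<Delta> * sqrt (ln (1 / ((1 - s) * \<delta>)) / (2 * real n))))
      \<ge> 1 - \<delta>"
proof -
  interpret prob_space M by fact
  note m = assms(2) and n = assms(3) and fin = assms(5) and PH = assms(6) and \<Delta> = assms(7)
    and Rm = assms(8) and Rb = assms(9) and indep = assms(12) and distr = assms(13)
  let ?A = "PiM {1..m} (\<lambda>_. N)" and ?IS = "index_samples mode n m"
  define Y where "Y = data_vec m X"
  define L1 where "L1 = ln (1 / (s * \<delta>))"
  define L2 where "L2 = ln (1 / ((1 - s) * \<delta>))"
  \<comment> \<open>Chosen so that \<open>exp (- L g)\<close> is the share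
    \<open>pmf P g * (s * \<delta>)\<close>. This real version is meaningful only on
    \<open>set_pmf P\<close>; \<open>slack\<close> below is its extended-real counterpart, infinite
    off the support.\<close>
  define L where "L g = ln (1 / pmf P g) + L1" for g
  define tA where "tA g = \<Delta> * sqrt (L g / (2 * real m))" for g
  define tB where "tB = \<Delta> * sqrt (L2 / (2 * real n))"
  define slack where "slack g = ereal \<Delta> * esqrt ((eln (1 / ereal (pmf P g)) + ereal L1) / ereal (2 * real m))" for g
  have hm [measurable]: "h \<in> measurable ?A (count_space H)" by fact
  have Ym [measurable]: "Y \<in> measurable M ?A"
    and \<sigma>m [measurable]: "\<sigma> \<in> measurable M (count_space ?IS)"
    using indep by (auto simp: indep_rvs_def Y_def)
  have hH: "h x \<in> H" if "x \<in> space ?A" for x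
    using measurable_space[OF hm that] by simp
  have s: "0 < s" "s < 1" using m n by (auto simp: assms(16) field_simps)
  have p1: "0 < s * \<delta>" "s * \<delta> < 1" and p2: "0 < (1 - s) * \<delta>" "(1 - s) * \<delta> < 1"
    using s \<open>0 < \<delta>\<close> \<open>\<delta> < 1\<close> mult_strict_mono[of s 1 \<delta> 1] mult_strict_mono[of "1 - s" 1 \<delta> 1] by auto
  have L1: "L1 \<ge> 0" "exp (- L1) = s * \<delta>" and L2: "L2 \<ge> 0" "exp (- L2) = (1 - s) * \<delta>"
    using p1 p2 by (auto simp: L1_def L2_def ln_div)
  have Pg: "pmf P g > 0" if "g \<in> set_pmf P" for g
    using that by (simp add: pmf_positive)
  have L: "L g \<ge> 0" "exp (- L g) = pmf P g * (s * \<delta>)" if "g \<in> set_pmf P" for g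
  proof -
    have "ln (pmf P g) \<le> 0" using Pg[OF that] pmf_le_1[of P g] by simp
    moreover have "L g = L1 - ln (pmf P g)" using Pg[OF that] by (simp add: L_def ln_div)
    ultimately show "L g \<ge> 0" using L1(1) by linarith
    show "exp (- L g) = pmf P g * (s * \<delta>)"
      using Pg[OF that] L1(2) by (simp add: L_def ln_div exp_diff exp_minus field_simps)
  qed

  have comp [measurable]: "(\<lambda>x. R g (x j)) \<in> borel_measurable ?A" if "g \<in> H" "j \<in> {1..m}" for g j
    using measurable_compose[OF measurable_component_singleton[OF that(2)] Rm[OF that(1)]] .
  have emp_m [measurable]: "(\<lambda>x. emp_risk R m x g) \<in> borel_measurable ?A" if "g \<in> H" for g
    unfolding emp_risk_def using comp[OF that] by simp
  have sub_m [measurable]: "(\<lambda>x. sub_risk R n f x g) \<in> borel_measurable ?A"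
    if "g \<in> H" "f \<in> ?IS" for g f
    unfolding sub_risk_def using comp[OF that(1)] index_samples_mem[OF that(2)]
    by (intro borel_measurable_times borel_measurable_sum borel_measurable_const) auto

  define BA where "BA g = {\<omega> \<in> space M. emp_risk R m (Y \<omega>) g \<le> exp_risk M R m X g - tA g}" for g
  \<comment> \<open>Unlike \<open>BA\<close>, this event is stated at \<open>h x\<close> directly:
    once \<open>x\<close> is fixed, so is \<open>h x\<close>, and no union over hypotheses is paid
    for.\<close>
  define D where "D f = {x \<in> space ?A. sub_risk R n f x (h x) + tB < emp_risk R m x (h x)}" for f
  define BB where "BB = {\<omega> \<in> space M. Y \<omega> \<in> D (\<sigma> \<omega>)}"
  define G where "G = {\<omega> \<in> space M. ereal (exp_risk M R m X (h (Y \<omega>)))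
      \<le> ereal (sub_risk R n (\<sigma> \<omega>) (Y \<omega>) (h (Y \<omega>))) + slack (h (Y \<omega>)) + ereal tB}"

  have D: "D f \<in> sets ?A" if "f \<in> ?IS" for f
  proof -
    have "Measurable.pred ?A (\<lambda>x. sub_risk R n f x (h x) + tB < emp_risk R m x (h x))"
    \<comment> \<open>As \<open>h\<close> has finitely many possible values, it suffices to check
      the predicate with \<open>h x\<close> replaced by a constant \<open>g\<close>.\<close>
    proof (rule measurable_compose_countable'[OF _ hm])
      fix g assume [measurable]: "g \<in> H"
      show "Measurable.pred ?A (\<lambda>x. sub_risk R n f x g + tB < emp_risk R m x g)"
        using that by measurable
    qed (use fin in \<open>simp add: countable_finite\<close>)
    thus ?thesis by (simp add: D_def pred_def)
  qed
  have BB: "BB \<in> events"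
  proof -
    have "Measurable.pred M (\<lambda>\<omega>. Y \<omega> \<in> D (\<sigma> \<omega>))"
    proof (rule measurable_compose_countable'[OF _ \<sigma>m])
      fix f assume "f \<in> ?IS"
      note D[OF this, measurable]
      show "Measurable.pred M (\<lambda>\<omega>. Y \<omega> \<in> D f)" by measurable
    qed (simp add: countable_finite finite_index_samples)
    thus ?thesis by (simp add: BB_def pred_def)
  qed
  have G: "G \<in> events"
  proof -
    have "Measurable.pred M (\<lambda>\<omega>. ereal (exp_risk M R m X (h (Y \<omega>)))
      \<le> ereal (sub_risk R n (\<sigma> \<omega>) (Y \<omega>) (h (Y \<omega>))) + slack (h (Y \<omega>)) + ereal tB)"
    proof (rule measurable_compose_countable'[OF _ \<sigma>m])
      fix f assume f: "f \<in> ?IS"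
      show "Measurable.pred M (\<lambda>\<omega>. ereal (exp_risk M R m X (h (Y \<omega>)))
        \<le> ereal (sub_risk R n f (Y \<omega>) (h (Y \<omega>))) + slack (h (Y \<omega>)) + ereal tB)"
      proof (rule measurable_compose_countable'[OF _ measurable_compose[OF Ym hm]])
        fix g assume g: "g \<in> H"
        note measurable_compose[OF Ym sub_m[OF g f], measurable]
        show "Measurable.pred M (\<lambda>\<omega>. ereal (exp_risk M R m X g)
          \<le> ereal (sub_risk R n f (Y \<omega>) g) + slack g + ereal tB)"
          by measurable
      qed (use fin in \<open>simp add: countable_finite\<close>)
    qed (simp add: countable_finite finite_index_samples)
    thus ?thesis by (simp add: G_def pred_def)
  qed
  have BA: "BA g \<in> events" if "g \<in> H" for g
  proof -
    note measurable_compose[OF Ym emp_m[OF that], measurable]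
    show ?thesis unfolding BA_def by measurable
  qed

  have pBA: "prob (BA g) \<le> pmf P g * (s * \<delta>)" if "g \<in> set_pmf P" for g
  proof -
    have "g \<in> H" using that PH by blast
    hence "prob (BA g) \<le> exp (- 2 * real m * (tA g)\<^sup>2 / \<Delta>\<^sup>2)"
      unfolding BA_def Y_def using m \<Delta> Rm Rb L(1)[OF that] assms(10)
      by (intro prob_emp_risk_le) (auto simp: tA_def)
    thus ?thesis
      using exp_Hoeffding_radius[OF \<Delta> m L(1)[OF that]] L(2)[OF that] by (simp add: tA_def)
  qed
  have pBB: "prob BB \<le> (1 - s) * \<delta>"
    unfolding BB_def
  proof (rule prob_indep_uniform_le[OF indep[folded Y_def] distr finite_index_samples D])
    fix x assume x: "x \<in> space ?A"
    \<comment> \<open>For fixed \<open>x\<close> these risks form a fixed bounded population from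
      which the indices sample.\<close>
    have c: "R (h x) (x j) \<in> {a..a + \<Delta>}" if "j \<in> {1..m}" for j
      using x hH[OF x] that by (intro Rb) (auto simp: space_PiM PiE_def Pi_def)
    have "card {f \<in> ?IS. x \<in> D f} \<le>
        card {f \<in> ?IS. (\<Sum>i=1..n. R (h x) (x (f i))) / n \<le> (\<Sum>j=1..m. R (h x) (x j)) / m - tB}"
      by (intro card_mono) (auto simp: finite_index_samples D_def sub_risk_def emp_risk_def)
    also have "real \<dots> \<le> card ?IS * exp (- 2 * real n * tB\<^sup>2 / (a + \<Delta> - a)\<^sup>2)"
      using m n assms(4) c \<Delta> L2 by (intro index_samples_tail) (auto simp: tB_def)
    also have "exp (- 2 * real n * tB\<^sup>2 / (a + \<Delta> - a)\<^sup>2) = (1 - s) * \<delta>"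
      using exp_Hoeffding_radius[OF \<Delta> n L2(1)] L2(2) by (simp add: tB_def)
    finally show "card {f \<in> ?IS. x \<in> D f} \<le> card ?IS * ((1 - s) * \<delta>)" by simp
  qed

  have finP: "finite (set_pmf P)" using PH fin by (rule finite_subset)
  have good: "space M \<subseteq> G \<union> ((\<Union>g\<in>set_pmf P. BA g) \<union> BB)"
  proof
    fix \<omega> assume \<omega>: "\<omega> \<in> space M"
    have x: "Y \<omega> \<in> space ?A" using measurable_space[OF Ym \<omega>] .
    let ?g = "h (Y \<omega>)"
    show "\<omega> \<in> G \<union> ((\<Union>g\<in>set_pmf P. BA g) \<union> BB)"
    proof (cases "pmf P ?g = 0")
      \<comment> \<open>A hypothesis of prior mass zero makes the right-hand side infinite, so the
        bound holds trivially and the union bound may run over \<open>set_pmf P\<close>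
        alone.\<close>
      case True
      hence "slack ?g = \<infinity>"
        using \<Delta> m eln_recip[of 0] by (simp add: slack_def)
      thus ?thesis using \<omega> by (simp add: G_def)
    next
      case False
      hence g: "?g \<in> set_pmf P" by (simp add: set_pmf_iff)
      have slack: "slack ?g = ereal (tA ?g)"
        using False m eln_recip[of "pmf P ?g"] by (simp add: slack_def tA_def L_def)
      show ?thesis
      proof (cases "\<omega> \<in> BA ?g \<or> \<omega> \<in> BB")
        case True
        with g show ?thesis by blast
      next
        case False
        hence "exp_risk M R m X ?g \<le> sub_risk R n (\<sigma> \<omega>) (Y \<omega>) ?g + tA ?g + tB"
          using \<omega> x by (auto simp: BA_def BB_def D_def)
        thus ?thesis using \<omega> by (simp add: G_def slack)
      qed
    qed
  qed
  have UA: "(\<Union>g\<in>set_pmf P. BA g) \<in> events"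
    using finP BA PH by (intro sets.finite_UN) auto
  have "1 = prob (space M)" by (simp add: prob_space)
  also have "\<dots> \<le> prob (G \<union> ((\<Union>g\<in>set_pmf P. BA g) \<union> BB))"
    using G UA BB by (intro finite_measure_mono good) auto
  also have "\<dots> \<le> prob G + (prob (\<Union>g\<in>set_pmf P. BA g) + prob BB)"
    using G UA BB by (intro order_trans[OF measure_Un_le] add_left_mono measure_Un_le) auto
  also have "prob (\<Union>g\<in>set_pmf P. BA g) \<le> (\<Sum>g\<in>set_pmf P. prob (BA g))"
    using finP BA PH by (intro finite_measure_subadditive_finite) auto
  also have "\<dots> \<le> (\<Sum>g\<in>set_pmf P. pmf P g * (s * \<delta>))"
    by (intro sum_mono pBA)
  \<comment> \<open>The prior sums to one over its support. With the share
    \<open>(1 - s) * \<delta>\<close> of \<open>BB\<close>, the total failure probability is at most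
    \<open>\<delta>\<close>.\<close>
  also have "\<dots> = s * \<delta>"
    using finP by (simp add: sum_pmf_eq_1 flip: sum_distrib_right)
  also note pBB
  finally have "1 - \<delta> \<le> prob G" by (simp add: algebra_simps)
  thus ?thesis
    by (simp only: G_def slack_def tB_def L1_def L2_def Y_def)
qed

end
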